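(* Let $(W,S)$ be a Coxeter system of type $\Lambda$ and let $\alpha$ and $\beta$ be two braid equivalent reduced expressions of dimension at least one. A braid sequence $b_1^{j_1},b_2^{j_2},\dots,b_k^{j_k}$ from $\alpha$ to $\beta$ is minimal if and only if each $j_i$ appears exactly once (that is, $j_1,\dots,j_k$ are pairwise distinct).
   Context: A Coxeter system $(W,S)$ consists of a finite set $S$ and the group $W=\langle S\mid (st)^{m(s,t)}=e\rangle$, where $m(s,s)=1$ and $m(s,t)=m(t,s)\in\{2,3,\dots\}\cup\{\infty\}$ for $s\neq t$ ($m(s,t)=\infty$ means no relation). Its Coxeter graph has vertex set $S$ and an edge $\{s,t\}$ whenever $m(s,t)\ge 3$. $(W,S)$ is of type $\Lambda$ if $m(s,t)\le 3$ for all $s,t\in S$ (simply laced) and the Coxeter graph contains no three-cycles (triangle free). A reduced expression for $w\in W$ is a word over $S$ of minimal length representing $w$. A braid move replaces three consecutive letters $sts$ by $tst$, where $m(s,t)=3$. Two reduced expressions are braid equivalent if they are related by a finite sequence of braid moves; $[\alpha]$ denotes the braid class (equivalence class) of $\alpha$. A braid shadow for a reduced expression $\alpha$ is a set of positions $\{i-1,i,i+1\}$ such that the letters of $\alpha$ in these positions form $sts$ with $m(s,t)=3$. $\mathcal{S}(\alpha)$ is the set of braid shadows for $\alpha$, and $\mathcal{S}([\alpha])=\bigcup_{\beta\in[\alpha]}\mathcal{S}(\beta)$. The dimension of $\alpha$ is $\dim(\alpha)=|\mathcal{S}([\alpha])|$, and the braid shadows in $\mathcal{S}([\alpha])$ are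 numbered $1,\dots,\dim(\alpha)$ from left to right. A braid sequence $b_1^{j_1},\dots,b_k^{j_k}$ from $\alpha$ to $\beta$ is a sequence of braid moves which, applied successively starting at $\alpha$, yields $\beta$, where the $i$th move $b_i^{j_i}$ is the braid move performed in the $j_i$th braid shadow of $\mathcal{S}([\alpha])$. It is minimal if no braid sequence from $\alpha$ to $\beta$ has fewer moves. *)

theory Defs
  imports "HOL-Library.Extended_Nat" "HOL-Algebra.Group"
begin

section \<open>Groups given by generators and relators\<close>

text \<open>A letter \<open>(s, True)\<close> stands for the generator \<open>s\<close>, a letter \<open>(s, False)\<close> for its formal
  inverse.\<close>

type_synonym 's gword = "('s \<times> bool) list"

definition gwords :: "'s set \<Rightarrow> 's gword set" where
  "gwords S = lists (S \<times> UNIV)"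

inductive_set pres_rel :: "'s set \<Rightarrow> 's gword set \<Rightarrow> ('s gword \<times> 's gword) set"
  for S :: "'s set" and R :: "'s gword set" where
  refl: "u \<in> gwords S \<Longrightarrow> (u, u) \<in> pres_rel S R"
| sym: "(u, v) \<in> pres_rel S R \<Longrightarrow> (v, u) \<in> pres_rel S R"
| trans: "(u, v) \<in> pres_rel S R \<Longrightarrow> (v, w) \<in> pres_rel S R \<Longrightarrow> (u, w) \<in> pres_rel S R"
| cancel: "u \<in> gwords S \<Longrightarrow> v \<in> gwords S \<Longrightarrow> s \<in> S \<Longrightarrow>
    (u @ [(s, b), (s, \<not> b)] @ v, u @ v) \<in> pres_rel S R"
| relator: "u \<in> gwords S \<Longrightarrow> v \<in> gwords S \<Longrightarrow> r \<in> R \<Longrightarrow> r \<in> gwords S \<Longrightarrow>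
    (u @ r @ v, u @ v) \<in> pres_rel S R"

definition presented_group :: "'s set \<Rightarrow> 's gword set \<Rightarrow> 's gword set monoid" where
  "presented_group S R =
    \<lparr>carrier = gwords S // pres_rel S R,
     mult = (\<lambda>A B. \<Union>a\<in>A. \<Union>b\<in>B. pres_rel S R `` {a @ b}),
     one = pres_rel S R `` {[]}\<rparr>"

lemma pres_rel_gwords: "(u, v) \<in> pres_rel S R \<Longrightarrow> u \<in> gwords S \<and> v \<in> gwords S"
  by (induction rule: pres_rel.induct) (auto simp: gwords_def)

lemma equiv_pres_rel: "equiv (gwords S) (pres_rel S R)"
  by (rule equivI)
    (auto simp: refl_on_def sym_def trans_def dest: pres_rel_gwords intro: pres_rel.intros)

lemma pres_rel_append_left:
  "(u, v) \<in> pres_rel S R \<Longrightarrow> w \<in> gwords S \<Longrightarrow> (w @ u, w @ v) \<in> pres_rel S R"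
proof (induction rule: pres_rel.induct)
  case (cancel u v s b)
  then show ?case using pres_rel.cancel[of "w @ u" S v s b R] by (simp add: gwords_def)
next
  case (relator u v r)
  then show ?case using pres_rel.relator[of "w @ u" S v r R] by (simp add: gwords_def)
qed (auto simp: gwords_def intro: pres_rel.intros)

lemma pres_rel_append_right:
  "(u, v) \<in> pres_rel S R \<Longrightarrow> w \<in> gwords S \<Longrightarrow> (u @ w, v @ w) \<in> pres_rel S R"
proof (induction rule: pres_rel.induct)
  case (cancel u v s b)
  then show ?case using pres_rel.cancel[of u S "v @ w" s b R] by (simp add: gwords_def)
next
  case (relator u v r)
  then show ?case using pres_rel.relator[of u S "v @ w" r R] by (simp add: gwords_def)
qed (auto simp: gwords_def intro: pres_rel.intros)

lemma presented_group_mult: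
  assumes "u \<in> gwords S" "v \<in> gwords S"
  shows "(pres_rel S R `` {u}) \<otimes>\<^bsub>presented_group S R\<^esub> (pres_rel S R `` {v}) =
    pres_rel S R `` {u @ v}"
proof -
  have cong: "pres_rel S R `` {a @ b} = pres_rel S R `` {u @ v}"
    if "a \<in> pres_rel S R `` {u}" "b \<in> pres_rel S R `` {v}" for a b
  proof -
    have "(u @ v, a @ v) \<in> pres_rel S R" "(a @ v, a @ b) \<in> pres_rel S R"
      using that assms
      by (auto intro: pres_rel_append_left pres_rel_append_right dest: pres_rel_gwords)
    then show ?thesis
      using equiv_class_eq[OF equiv_pres_rel] pres_rel.trans by metis
  qed
  moreover have "u \<in> pres_rel S R `` {u}" "v \<in> pres_rel S R `` {v}"
    using assms by (auto intro: pres_rel.refl)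
  ultimately have "(\<Union>a\<in>pres_rel S R `` {u}. \<Union>b\<in>pres_rel S R `` {v}. pres_rel S R `` {a @ b}) =
      pres_rel S R `` {u @ v}"
    by blast
  then show ?thesis by (simp add: presented_group_def)
qed

lemma pres_rel_inverse:
  "u \<in> gwords S \<Longrightarrow> (rev (map (\<lambda>(s, b). (s, \<not> b)) u) @ u, []) \<in> pres_rel S R"
proof (induction u)
  case Nil
  then show ?case by (simp add: pres_rel.refl)
next
  case (Cons x u)
  obtain s b where x: "x = (s, b)" by (cases x)
  let ?u' = "rev (map (\<lambda>(s, b). (s, \<not> b)) u)"
  have "?u' \<in> gwords S" "u \<in> gwords S" "s \<in> S"
    using Cons.prems x by (auto simp: gwords_def)
  then have "(?u' @ [(s, \<not> b), (s, \<not> \<not> b)] @ u, ?u' @ u) \<in> pres_rel S R"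
    by (intro pres_rel.cancel)
  then show ?case
    using Cons.IH \<open>u \<in> gwords S\<close> x by (auto intro: pres_rel.trans)
qed

lemma group_presented_group: "group (presented_group S R)"
proof (rule groupI)
  let ?G = "presented_group S R"
  have ex: "\<exists>u\<in>gwords S. x = pres_rel S R `` {u}" if "x \<in> carrier ?G" for x
    using that by (auto simp: presented_group_def elim: quotientE)
  have cl: "pres_rel S R `` {u} \<in> carrier ?G" if "u \<in> gwords S" for u
    using that by (auto simp: presented_group_def intro: quotientI)
  have app: "u @ v \<in> gwords S" if "u \<in> gwords S" "v \<in> gwords S" for u v :: "'a gword"
    using that by (simp add: gwords_def)
  have nil: "[] \<in> gwords S" by (simp add: gwords_def)
  have one: "\<one>\<^bsub>?G\<^esub> = pres_rel S R `` {[]}" by (simp add: presented_group_def)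
  show "x \<otimes>\<^bsub>?G\<^esub> y \<in> carrier ?G" if "x \<in> carrier ?G" "y \<in> carrier ?G" for x y
    using ex[OF that(1)] ex[OF that(2)] by (auto simp: presented_group_mult app cl)
  show "\<one>\<^bsub>?G\<^esub> \<in> carrier ?G" by (simp add: one cl nil)
  show "x \<otimes>\<^bsub>?G\<^esub> y \<otimes>\<^bsub>?G\<^esub> z = x \<otimes>\<^bsub>?G\<^esub> (y \<otimes>\<^bsub>?G\<^esub> z)"
    if "x \<in> carrier ?G" "y \<in> carrier ?G" "z \<in> carrier ?G" for x y z
    using ex[OF that(1)] ex[OF that(2)] ex[OF that(3)] by (auto simp: presented_group_mult app)
  show "\<one>\<^bsub>?G\<^esub> \<otimes>\<^bsub>?G\<^esub> x = x" if "x \<in> carrier ?G" for x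
    using ex[OF that] by (auto simp: presented_group_mult one nil)
  show "\<exists>y\<in>carrier ?G. y \<otimes>\<^bsub>?G\<^esub> x = \<one>\<^bsub>?G\<^esub>" if x: "x \<in> carrier ?G" for x
  proof -
    obtain u where u: "u \<in> gwords S" "x = pres_rel S R `` {u}" using ex[OF x] by blast
    let ?v = "rev (map (\<lambda>(s, b). (s, \<not> b)) u)"
    have v: "?v \<in> gwords S" using u(1) by (auto simp: gwords_def)
    have "pres_rel S R `` {?v} \<otimes>\<^bsub>?G\<^esub> x = \<one>\<^bsub>?G\<^esub>"
      using equiv_class_eq[OF equiv_pres_rel pres_rel_inverse[OF u(1)]] u v
      by (simp only: presented_group_mult one)
    then show ?thesis using cl[OF v] by blast
  qed
qed

section \<open>Coxeter systems\<close>

definition coxeter_matrix :: "'s set \<Rightarrow> ('s \<Rightarrow> 's \<Rightarrow> enat) \<Rightarrow> bool" where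
  "coxeter_matrix S m \<longleftrightarrow> finite S \<and> (\<forall>s\<in>S. m s s = 1) \<and>
    (\<forall>s\<in>S. \<forall>t\<in>S. s \<noteq> t \<longrightarrow> m s t = m t s \<and> 2 \<le> m s t)"

definition coxeter_relators :: "'s set \<Rightarrow> ('s \<Rightarrow> 's \<Rightarrow> enat) \<Rightarrow> 's gword set" where
  "coxeter_relators S m =
    {concat (replicate n [(s, True), (t, True)]) | s t n. s \<in> S \<and> t \<in> S \<and> m s t = enat n}"

definition coxeter_group :: "'s set \<Rightarrow> ('s \<Rightarrow> 's \<Rightarrow> enat) \<Rightarrow> 's gword set monoid" where
  "coxeter_group S m = presented_group S (coxeter_relators S m)"

definition generator :: "'s set \<Rightarrow> ('s \<Rightarrow> 's \<Rightarrow> enat) \<Rightarrow> 's \<Rightarrow> 's gword set" where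
  "generator S m s = pres_rel S (coxeter_relators S m) `` {[(s, True)]}"

definition coxeter_edge :: "'s set \<Rightarrow> ('s \<Rightarrow> 's \<Rightarrow> enat) \<Rightarrow> 's \<Rightarrow> 's \<Rightarrow> bool" where
  "coxeter_edge S m s t \<longleftrightarrow> s \<in> S \<and> t \<in> S \<and> s \<noteq> t \<and> 3 \<le> m s t"

definition type_Lambda :: "'s set \<Rightarrow> ('s \<Rightarrow> 's \<Rightarrow> enat) \<Rightarrow> bool" where
  "type_Lambda S m \<longleftrightarrow> coxeter_matrix S m \<and> (\<forall>s\<in>S. \<forall>t\<in>S. m s t \<le> 3) \<and>
    \<not> (\<exists>s t u. coxeter_edge S m s t \<and> coxeter_edge S m t u \<and> coxeter_edge S m u s)"

section \<open>Reduced expressions\<close>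

definition word_value :: "'s set \<Rightarrow> ('s \<Rightarrow> 's \<Rightarrow> enat) \<Rightarrow> 's list \<Rightarrow> 's gword set" where
  "word_value S m \<alpha> =
    foldr (\<lambda>s x. generator S m s \<otimes>\<^bsub>coxeter_group S m\<^esub> x) \<alpha> \<one>\<^bsub>coxeter_group S m\<^esub>"

definition represents :: "'s set \<Rightarrow> ('s \<Rightarrow> 's \<Rightarrow> enat) \<Rightarrow> 's list \<Rightarrow> 's gword set \<Rightarrow> bool" where
  "represents S m \<alpha> w \<longleftrightarrow> \<alpha> \<in> lists S \<and> word_value S m \<alpha> = w"

definition reduced_expression_for ::
    "'s set \<Rightarrow> ('s \<Rightarrow> 's \<Rightarrow> enat) \<Rightarrow> 's gword set \<Rightarrow> 's list \<Rightarrow> bool" where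
  "reduced_expression_for S m w \<alpha> \<longleftrightarrow>
    represents S m \<alpha> w \<and> (\<forall>\<beta>. represents S m \<beta> w \<longrightarrow> length \<alpha> \<le> length \<beta>)"

definition reduced_expression :: "'s set \<Rightarrow> ('s \<Rightarrow> 's \<Rightarrow> enat) \<Rightarrow> 's list \<Rightarrow> bool" where
  "reduced_expression S m \<alpha> \<longleftrightarrow>
    (\<exists>w\<in>carrier (coxeter_group S m). reduced_expression_for S m w \<alpha>)"

section \<open>Braid shadows and braid sequences\<close>

text \<open>Positions in a word are counted from 0. A braid is addressed by its middle position \<open>i\<close>.\<close>

definition braid_at :: "('s \<Rightarrow> 's \<Rightarrow> enat) \<Rightarrow> 's list \<Rightarrow> nat \<Rightarrow> bool" where
  "braid_at m \<alpha> i \<longleftrightarrow> 1 \<le> i \<and> i + 1 < length \<alpha> \<and>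
    \<alpha> ! (i - 1) = \<alpha> ! (i + 1) \<and> m (\<alpha> ! (i - 1)) (\<alpha> ! i) = 3"

definition shadows :: "('s \<Rightarrow> 's \<Rightarrow> enat) \<Rightarrow> 's list \<Rightarrow> nat set set" where
  "shadows m \<alpha> = {{i - 1, i, i + 1} | i. braid_at m \<alpha> i}"

definition braid_move_in ::
    "('s \<Rightarrow> 's \<Rightarrow> enat) \<Rightarrow> nat set \<Rightarrow> 's list \<Rightarrow> 's list \<Rightarrow> bool" where
  "braid_move_in m X \<alpha> \<beta> \<longleftrightarrow> (\<exists>i. braid_at m \<alpha> i \<and> X = {i - 1, i, i + 1} \<and>
    \<beta> = \<alpha>[i - 1 := \<alpha> ! i, i := \<alpha> ! (i - 1), i + 1 := \<alpha> ! i])"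

definition braid_move :: "('s \<Rightarrow> 's \<Rightarrow> enat) \<Rightarrow> 's list \<Rightarrow> 's list \<Rightarrow> bool" where
  "braid_move m \<alpha> \<beta> \<longleftrightarrow> (\<exists>X. braid_move_in m X \<alpha> \<beta>)"

definition braid_equivalent :: "('s \<Rightarrow> 's \<Rightarrow> enat) \<Rightarrow> 's list \<Rightarrow> 's list \<Rightarrow> bool" where
  "braid_equivalent m = (braid_move m)\<^sup>*\<^sup>*"

definition braid_class :: "('s \<Rightarrow> 's \<Rightarrow> enat) \<Rightarrow> 's list \<Rightarrow> 's list set" where
  "braid_class m \<alpha> = {\<beta>. braid_equivalent m \<alpha> \<beta>}"

definition class_shadows :: "('s \<Rightarrow> 's \<Rightarrow> enat) \<Rightarrow> 's list \<Rightarrow> nat set set" where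
  "class_shadows m \<alpha> = (\<Union>\<beta>\<in>braid_class m \<alpha>. shadows m \<beta>)"

definition dimension :: "('s \<Rightarrow> 's \<Rightarrow> enat) \<Rightarrow> 's list \<Rightarrow> nat" where
  "dimension m \<alpha> = card (class_shadows m \<alpha>)"

text \<open>The place, counted from 1, of \<open>X\<close> when the shadows of the braid class are listed from left
  to right; a shadow consists of three consecutive positions, so its minimum determines it.\<close>

definition shadow_number :: "('s \<Rightarrow> 's \<Rightarrow> enat) \<Rightarrow> 's list \<Rightarrow> nat set \<Rightarrow> nat" where
  "shadow_number m \<alpha> X = card {Y \<in> class_shadows m \<alpha>. Min Y \<le> Min X}"

text \<open>The current word and the number of a shadow determine the move, so a braid sequence is
  encoded by the list of its shadow numbers. The first word argument \<open>\<gamma>\<close> of \<open>braid_path\<close> is the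
  word whose braid class supplies the numbering; it stays fixed along the path.\<close>

fun braid_path ::
    "('s \<Rightarrow> 's \<Rightarrow> enat) \<Rightarrow> 's list \<Rightarrow> 's list \<Rightarrow> nat list \<Rightarrow> 's list \<Rightarrow> bool" where
  "braid_path m \<gamma> \<alpha> [] \<beta> \<longleftrightarrow> \<alpha> = \<beta>"
| "braid_path m \<gamma> \<alpha> (j # js) \<beta> \<longleftrightarrow>
    (\<exists>X \<alpha>'. X \<in> class_shadows m \<gamma> \<and> shadow_number m \<gamma> X = j \<and>
      braid_move_in m X \<alpha> \<alpha>' \<and> braid_path m \<gamma> \<alpha>' js \<beta>)"

definition braid_sequence ::
    "('s \<Rightarrow> 's \<Rightarrow> enat) \<Rightarrow> 's list \<Rightarrow> nat list \<Rightarrow> 's list \<Rightarrow> bool" where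
  "braid_sequence m \<alpha> js \<beta> \<longleftrightarrow> braid_path m \<alpha> \<alpha> js \<beta>"

definition minimal_braid_sequence ::
    "('s \<Rightarrow> 's \<Rightarrow> enat) \<Rightarrow> 's list \<Rightarrow> nat list \<Rightarrow> 's list \<Rightarrow> bool" where
  "minimal_braid_sequence m \<alpha> js \<beta> \<longleftrightarrow> braid_sequence m \<alpha> js \<beta> \<and>
    (\<forall>js'. braid_sequence m \<alpha> js' \<beta> \<longrightarrow> length js \<le> length js')"

end

theory Submission
  imports Defs
begin

text \<open>A braid move in the shadow \<open>{i - 1, i, i + 1}\<close> swaps the letter in the middle position \<open>i\<close>
  with the letter that its two neighbours share. So a braid sequence is a list of middle
  positions, and since the numbering of shadows is injective, the claim may be read for such
  lists: a path from \<open>\<alpha>\<close> to \<open>\<beta>\<close> is shortest iff its middle positions are distinct.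

  Everything rests on the fact that two neighbouring positions \<open>i\<close> and \<open>i + 1\<close> are never both
  middle positions in one braid class of reduced expressions
  (\<open>no_adjacent_centers_on_path\<close>). On a shortest path between words that have a braid around \<open>i\<close>
  and \<open>i + 1\<close> respectively, every move is far to the left or far to the right of these two
  positions. The two kinds of moves do not interact, so performing only the right ones yields a
  word with a factor \<open>stst\<close>, which is not reduced.

  Consequently the letter in a middle position \<open>i\<close> changes only through moves at \<open>i\<close>. If a path
  moves at \<open>i\<close> exactly once, then \<open>\<alpha>\<close> and \<open>\<beta>\<close> differ at \<open>i\<close>, so every path must move at \<open>i\<close>
  (\<open>distinct_centers_forced\<close>); hence distinct middle positions give a shortest path.

  Conversely, if some middle position is repeated, consider a repetition \<open>i, M, i\<close> with \<open>M\<close>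
  distinct and avoiding \<open>i\<close>. Let \<open>M\<close> contain \<open>i + 2\<close>. After the first move at \<open>i\<close>, the positions
  \<open>i, i + 1, i + 2\<close> carry letters \<open>a, b, c\<close> where \<open>a, b\<close> are joined in the Coxeter graph. The
  single move at \<open>i + 2\<close> requires \<open>b, c\<close> to be joined and leaves \<open>a, c, b\<close>, and then the second
  move at \<open>i\<close> requires \<open>a, c\<close> to be joined: a triangle. The case of \<open>i - 2\<close> is symmetric
  (\<open>overlapping_center_repeats\<close>). So all shadows used in \<open>M\<close> are disjoint from the one of \<open>i\<close>, and
  both moves at \<open>i\<close> can be dropped (\<open>cancel_repeated_center\<close>).\<close>

section \<open>Braid moves addressed by their middle position\<close>

definition shadow :: "nat \<Rightarrow> nat set" where
  "shadow i = {i - 1, i, i + 1}"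

definition flip :: "nat \<Rightarrow> 's list \<Rightarrow> 's list" where
  "flip i w = w[i - 1 := w ! i, i := w ! (i - 1), i + 1 := w ! i]"

text \<open>A word and a middle position determine a braid move, so a path of moves is given by the
  list of middle positions and its last word by the first one.\<close>

fun center_path :: "('s \<Rightarrow> 's \<Rightarrow> enat) \<Rightarrow> 's list \<Rightarrow> nat list \<Rightarrow> 's list \<Rightarrow> bool" where
  "center_path m w [] w' \<longleftrightarrow> w = w'"
| "center_path m w (i # M) w' \<longleftrightarrow> braid_at m w i \<and> center_path m (flip i w) M w'"

lemma length_flip [simp]: "length (flip i w) = length w"
  by (simp add: flip_def)

lemma nth_flip:
  assumes "braid_at m w i"
  shows "flip i w ! p =
    (if p = i then w ! (i - 1) else if p = i - 1 \<or> p = i + 1 then w ! i else w ! p)"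
  using assms by (auto simp: flip_def braid_at_def nth_list_update)

lemma nth_flip_outside: "p \<notin> shadow i \<Longrightarrow> flip i w ! p = w ! p"
  by (auto simp: flip_def shadow_def)

lemma braid_at_cong:
  assumes "length v = length w" "\<And>p. p \<in> shadow i \<Longrightarrow> v ! p = w ! p"
  shows "braid_at m v i \<longleftrightarrow> braid_at m w i"
  using assms by (auto simp: braid_at_def shadow_def)

lemma center_path_append:
  "center_path m w (M @ N) w' \<longleftrightarrow> (\<exists>x. center_path m w M x \<and> center_path m x N w')"
  by (induction M arbitrary: w) auto

lemma center_path_length: "center_path m w M w' \<Longrightarrow> length w' = length w"
  by (induction M arbitrary: w) auto

lemma center_path_unmoved:
  "center_path m w M w' \<Longrightarrow> (\<And>j. j \<in> set M \<Longrightarrow> p \<notin> shadow j) \<Longrightarrow> w' ! p = w ! p"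
  by (induction M arbitrary: w) (auto simp: nth_flip_outside)

text \<open>Moves inside a window \<open>P\<close> and moves outside it do not interact, so the inner ones can be
  performed alone, also from another word with the same letters in \<open>P\<close>.\<close>

lemma center_path_localize:
  assumes "center_path m w M w'"
    and "\<And>j. j \<in> set M \<Longrightarrow> shadow j \<subseteq> P \<or> shadow j \<inter> P = {}"
    and "length v = length w" and "\<And>p. p \<in> P \<Longrightarrow> v ! p = w ! p"
  shows "\<exists>v'. center_path m v (filter (\<lambda>j. shadow j \<subseteq> P) M) v' \<and>
    (\<forall>p. v' ! p = (if p \<in> P then w' else v) ! p)"
  using assms
proof (induction M arbitrary: w v)
  case Nil
  then show ?case by auto
next
  case (Cons i M)
  have b: "braid_at m w i" and path: "center_path m (flip i w) M w'"
    using Cons.prems(1) by auto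
  show ?case
  proof (cases "shadow i \<subseteq> P")
    case True
    have bv: "braid_at m v i"
      using b braid_at_cong[OF Cons.prems(3), of i m] Cons.prems(4) True by blast
    have mem: "i - 1 \<in> P" "i \<in> P"
      using True by (auto simp: shadow_def)
    have agree: "flip i v ! p = flip i w ! p" if "p \<in> P" for p
      using that mem Cons.prems(4) by (simp add: nth_flip[OF b] nth_flip[OF bv])
    obtain v' where v': "center_path m (flip i v) (filter (\<lambda>j. shadow j \<subseteq> P) M) v'"
      "\<forall>p. v' ! p = (if p \<in> P then w' else flip i v) ! p"
      using Cons.IH[OF path, of "flip i v"] Cons.prems(2,3) agree by auto
    have "v' ! p = (if p \<in> P then w' else v) ! p" for p
      using v'(2) True nth_flip_outside[of p i v] by auto
    then show ?thesis
      using v'(1) bv True by auto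
  next
    case False
    then have "shadow i \<inter> P = {}"
      using Cons.prems(2)[of i] by auto
    then have agree: "v ! p = flip i w ! p" if "p \<in> P" for p
      using that Cons.prems(4)[OF that] nth_flip_outside[of p i w] by (metis disjoint_iff)
    show ?thesis
      using Cons.IH[OF path, of v] Cons.prems(2,3) agree False by auto
  qed
qed

lemma braid_move_in_iff:
  "braid_move_in m X w w' \<longleftrightarrow> (\<exists>i. braid_at m w i \<and> X = shadow i \<and> w' = flip i w)"
  by (simp add: braid_move_in_def shadow_def flip_def)

lemma braid_at_factor:
  assumes "braid_at m w i"
  obtains u s t v where "w = u @ [s, t, s] @ v" "flip i w = u @ [t, s, t] @ v"
    "length u = i - 1" "m s t = 3"
proof -
  obtain k where i: "i = Suc k" and len: "k + 2 < length w"
    and eq: "w ! (k + 2) = w ! k" and m: "m (w ! k) (w ! Suc k) = 3"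
    using assms by (cases i) (auto simp: braid_at_def)
  let ?u = "take k w" and ?v = "drop (k + 3) w"
  have w: "w = ?u @ [w ! k, w ! Suc k, w ! k] @ ?v"
    using len eq Cons_nth_drop_Suc[of k w] Cons_nth_drop_Suc[of "Suc k" w]
      Cons_nth_drop_Suc[of "k + 2" w] append_take_drop_id[of k w]
    by (simp add: numeral_3_eq_3)
  have "flip i (?u @ [w ! k, w ! Suc k, w ! k] @ ?v) = ?u @ [w ! Suc k, w ! k, w ! Suc k] @ ?v"
    using len by (simp add: flip_def i list_update_append nth_append)
  then show thesis
    using that[of ?u "w ! k" "w ! Suc k" ?v] w m i len by simp
qed

section \<open>Braid moves on reduced expressions\<close>

text \<open>Equality in the group, expressed by the defining congruence on words, where factors can be
  replaced directly.\<close>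

definition same_element :: "'s set \<Rightarrow> ('s \<Rightarrow> 's \<Rightarrow> enat) \<Rightarrow> 's list \<Rightarrow> 's list \<Rightarrow> bool" where
  "same_element S m u v \<longleftrightarrow>
    (map (\<lambda>s. (s, True)) u, map (\<lambda>s. (s, True)) v) \<in> pres_rel S (coxeter_relators S m)"

lemma positive_gword: "u \<in> lists S \<Longrightarrow> map (\<lambda>s. (s, True)) u \<in> gwords S"
  by (auto simp: gwords_def)

lemma word_value_eq_class:
  "u \<in> lists S \<Longrightarrow>
    word_value S m u = pres_rel S (coxeter_relators S m) `` {map (\<lambda>s. (s, True)) u}"
proof (induction u)
  case Nil
  then show ?case
    by (simp add: word_value_def coxeter_group_def presented_group_def)
next
  case (Cons s u)
  have "s \<in> S" "u \<in> lists S" using Cons.prems by auto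
  moreover have "[(s, True)] \<in> gwords S" using \<open>s \<in> S\<close> by (simp add: gwords_def)
  moreover have "word_value S m (s # u) =
      generator S m s \<otimes>\<^bsub>coxeter_group S m\<^esub> word_value S m u"
    by (simp add: word_value_def)
  ultimately show ?case
    using Cons.IH positive_gword[of u S]
    by (simp add: generator_def coxeter_group_def presented_group_mult)
qed

lemma reduced_expression_iff:
  "reduced_expression S m w \<longleftrightarrow>
    w \<in> lists S \<and> (\<forall>v\<in>lists S. same_element S m w v \<longrightarrow> length w \<le> length v)"
proof -
  have eq: "word_value S m w = word_value S m v \<longleftrightarrow> same_element S m w v"
    if "w \<in> lists S" "v \<in> lists S" for v
    using that eq_equiv_class_iff[OF equiv_pres_rel positive_gword positive_gword, of w S v]
    by (auto simp: word_value_eq_class same_element_def)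
  have "word_value S m w \<in> carrier (coxeter_group S m)" if "w \<in> lists S"
    using that positive_gword[OF that]
    by (simp add: word_value_eq_class coxeter_group_def presented_group_def quotientI)
  then show ?thesis
    unfolding reduced_expression_def reduced_expression_for_def represents_def
    using eq by metis
qed

locale coxeter_system =
  fixes S :: "'s set" and m :: "'s \<Rightarrow> 's \<Rightarrow> enat"
  assumes coxeter_matrix: "coxeter_matrix S m"
begin

lemma m_eq_3_sym: "s \<in> S \<Longrightarrow> t \<in> S \<Longrightarrow> m s t = 3 \<Longrightarrow> m t s = 3"
  using coxeter_matrix by (metis coxeter_matrix_def)

lemma m_eq_3_neq: "s \<in> S \<Longrightarrow> m s t = 3 \<Longrightarrow> s \<noteq> t"
  using coxeter_matrix by (auto simp: coxeter_matrix_def)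

lemma same_element_sym: "same_element S m u v \<Longrightarrow> same_element S m v u"
  unfolding same_element_def by (rule pres_rel.sym)

lemma same_element_trans [trans]:
  "same_element S m u v \<Longrightarrow> same_element S m v w \<Longrightarrow> same_element S m u w"
  unfolding same_element_def by (rule pres_rel.trans)

lemma same_element_relator:
  assumes "u \<in> lists S" "v \<in> lists S" "s \<in> S" "t \<in> S" "m s t = enat n"
  shows "same_element S m (u @ concat (replicate n [s, t]) @ v) (u @ v)"
proof -
  let ?r = "concat (replicate n [(s, True), (t, True)])"
  have "?r \<in> coxeter_relators S m"
    using assms by (auto simp: coxeter_relators_def)
  moreover have "?r \<in> gwords S"
    using assms(3,4) by (induction n) (auto simp: gwords_def)
  moreover have "map (\<lambda>s. (s, True)) (concat (replicate n [s, t])) = ?r"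
    by (simp add: map_concat)
  ultimately show ?thesis
    unfolding same_element_def
    using pres_rel.relator[OF positive_gword positive_gword, OF assms(1,2)] by simp
qed

lemma same_element_square:
  assumes "u \<in> lists S" "v \<in> lists S" "s \<in> S"
  shows "same_element S m (u @ [s, s] @ v) (u @ v)"
  using same_element_relator[OF assms assms(3), of 1] assms(3) coxeter_matrix
  by (auto simp: coxeter_matrix_def one_enat_def)

text \<open>Inserting squares turns \<open>sts\<close> into \<open>(st)\<^sup>3 tst\<close>, and \<open>(st)\<^sup>3\<close> is a relator.\<close>

lemma same_element_braid:
  assumes "u \<in> lists S" "v \<in> lists S" "s \<in> S" "t \<in> S" "m s t = 3"
  shows "same_element S m (u @ [s, t, s] @ v) (u @ [t, s, t] @ v)"
proof -
  have "same_element S m (u @ [s, t, s] @ v) (u @ [s, t, s, t, t] @ v)"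
    using same_element_sym[OF same_element_square[of "u @ [s, t, s]" v t]] assms by simp
  also have "same_element S m \<dots> (u @ [s, t, s, t, s, s, t] @ v)"
    using same_element_sym[OF same_element_square[of "u @ [s, t, s, t]" "t # v" s]] assms by simp
  also have "same_element S m \<dots> (u @ [s, t, s, t, s, t, t, s, t] @ v)"
    using same_element_sym[OF same_element_square[of "u @ [s, t, s, t, s]" "[s, t] @ v" t]] assms
    by simp
  also have "same_element S m \<dots> (u @ [t, s, t] @ v)"
    using same_element_relator[of u "[t, s, t] @ v" s t 3] assms
    by (simp add: numeral_eq_enat numeral_3_eq_3)
  finally show ?thesis .
qed

lemma reduced_flip:
  assumes red: "reduced_expression S m w" and b: "braid_at m w i"
  shows "reduced_expression S m (flip i w)"
proof -
  obtain u s t v where w: "w = u @ [s, t, s] @ v" "flip i w = u @ [t, s, t] @ v" "m s t = 3"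
    using braid_at_factor[OF b] by metis
  have S: "u \<in> lists S" "v \<in> lists S" "s \<in> S" "t \<in> S"
    using red by (auto simp: w(1) reduced_expression_iff)
  have "same_element S m w (flip i w)"
    using same_element_braid[OF S w(3)] w by simp
  then show ?thesis
    using red S w same_element_trans by (auto simp: reduced_expression_iff)
qed

text \<open>Adjacent middle positions mean a factor \<open>stst\<close>, which equals \<open>tstt\<close> and so \<open>ts\<close>
  in the group.\<close>

lemma reduced_no_adjacent_braids:
  assumes red: "reduced_expression S m w" and b: "braid_at m w i"
  shows "\<not> braid_at m w (i + 1)"
proof
  assume b': "braid_at m w (i + 1)"
  obtain u s t v where w: "w = u @ [s, t, s] @ v" "length u = i - 1" "m s t = 3"
    using braid_at_factor[OF b] by metis
  have i: "i = Suc (length u)" using b w(2) by (simp add: braid_at_def)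
  then obtain v' where v: "v = t # v'"
    using b' by (cases v) (auto simp: braid_at_def w(1) nth_append)
  have S: "u \<in> lists S" "v' \<in> lists S" "s \<in> S" "t \<in> S"
    using red by (auto simp: w(1) v reduced_expression_iff)
  have "same_element S m w (u @ [t, s, t, t] @ v')"
    using same_element_braid[of u v s t] S w v by simp
  also have "same_element S m \<dots> (u @ [t, s] @ v')"
    using same_element_square[of "u @ [t, s]" v' t] S by simp
  finally have "same_element S m w (u @ [t, s] @ v')" .
  moreover have "u @ [t, s] @ v' \<in> lists S" using S by simp
  ultimately have "length w \<le> length (u @ [t, s] @ v')"
    using red unfolding reduced_expression_iff by blast
  then show False
    by (simp add: w(1) v)
qed

lemma reduced_center_path:
  "reduced_expression S m w \<Longrightarrow> center_path m w M w' \<Longrightarrow> reduced_expression S m w'"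
  by (induction M arbitrary: w) (auto intro: reduced_flip)

lemma reduced_nth: "reduced_expression S m w \<Longrightarrow> p < length w \<Longrightarrow> w ! p \<in> S"
  by (auto simp: reduced_expression_iff)

lemma braid_at_flip:
  assumes "reduced_expression S m w" "braid_at m w i"
  shows "braid_at m (flip i w) i"
proof -
  have "w ! (i - 1) \<in> S" "w ! i \<in> S"
    using assms by (auto simp: braid_at_def intro: reduced_nth)
  then show ?thesis
    using assms(2) m_eq_3_sym by (auto simp: braid_at_def nth_flip[OF assms(2)])
qed

lemma flip_flip:
  assumes "reduced_expression S m w" "braid_at m w i"
  shows "flip i (flip i w) = w"
  by (rule nth_equalityI)
    (use assms(2) in \<open>auto simp: nth_flip[OF braid_at_flip[OF assms]] nth_flip[OF assms(2)]
      braid_at_def\<close>)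

lemma center_path_rev:
  "reduced_expression S m w \<Longrightarrow> center_path m w M w' \<Longrightarrow> center_path m w' (rev M) w"
proof (induction M arbitrary: w)
  case (Cons i M)
  have b: "braid_at m w i" and path: "center_path m (flip i w) M w'"
    using Cons.prems(2) by auto
  then show ?case
    using Cons.IH[OF reduced_flip[OF Cons.prems(1) b] path]
      braid_at_flip[OF Cons.prems(1) b] flip_flip[OF Cons.prems(1) b]
    by (auto simp: center_path_append)
qed simp

section \<open>Middle positions of one braid class are never adjacent\<close>

text \<open>The proof considers a counterexample of minimal length. A move at \<open>i - 1\<close>, \<open>i\<close>, \<open>i + 1\<close> or
  \<open>i + 2\<close> would cut it into a shorter one, read forwards or backwards. So positions \<open>i\<close> and
  \<open>i + 1\<close> never change, and the moves right of them, performed alone, lead to adjacent braids in a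
  single word.\<close>

lemma no_adjacent_centers_on_path:
  assumes "reduced_expression S m w" "center_path m w M w'" "braid_at m w i"
  shows "\<not> braid_at m w' (i + 1)"
  using assms
proof (induction "length M" arbitrary: w M w' i rule: less_induct)
  case less
  note red = less.prems(1) and path = less.prems(2) and start = less.prems(3)
  have fwd: False if "length N < length M" "reduced_expression S m x" "center_path m x N y"
    "braid_at m x j" "braid_at m y (j + 1)" for x N y j
    using less.hyps that by blast
  have bwd: False if "length N < length M" "reduced_expression S m x" "center_path m x N y"
    "braid_at m x (j + 1)" "braid_at m y j" for x N y j
    using fwd[of "rev N" y x j] that center_path_rev reduced_center_path by auto
  show ?case
  proof
    assume final: "braid_at m w' (i + 1)"
    have far: "j + 2 \<le> i \<or> i + 3 \<le> j" if j: "j \<in> set M" for j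
    proof (rule ccontr)
      assume "\<not> (j + 2 \<le> i \<or> i + 3 \<le> j)"
      then consider "i = j + 1" | "j = i" | "j = i + 1" | "j = (i + 1) + 1"
        by linarith
      moreover obtain M1 M2 where M: "M = M1 @ j # M2"
        using j by (meson split_list)
      obtain x where x: "center_path m w M1 x" "braid_at m x j" "center_path m (flip j x) M2 w'"
        using path by (auto simp: M center_path_append)
      have redx: "reduced_expression S m x" using red x(1) reduced_center_path by blast
      have y: "reduced_expression S m (flip j x)" "braid_at m (flip j x) j"
        using redx x(2) reduced_flip braid_at_flip by auto
      have "length M1 < length M" "length M2 < length M" by (auto simp: M)
      ultimately show False
        using fwd bwd x y red start final by metis
    qed
    have i1: "1 \<le> i" using start by (simp add: braid_at_def)
    have pos: "1 \<le> j" if j: "j \<in> set M" for j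
    proof -
      obtain M1 M2 where "M = M1 @ j # M2" using j by (meson split_list)
      then show ?thesis using path by (auto simp: center_path_append braid_at_def)
    qed
    \<comment> \<open>The window that separates the moves on the right from those on the left.\<close>
    let ?P = "{i..}"
    have side: "shadow j \<subseteq> ?P \<or> shadow j \<inter> ?P = {}" if "j \<in> set M" for j
      using far[OF that] pos[OF that] by (auto simp: shadow_def)
    obtain v where v: "center_path m w (filter (\<lambda>j. shadow j \<subseteq> ?P) M) v"
      "\<forall>p. v ! p = (if p \<in> ?P then w' else w) ! p"
      using center_path_localize[OF path, of ?P w] side by auto
    have fix1: "w' ! i = w ! i" "w' ! (i + 1) = w ! (i + 1)"
      by (rule center_path_unmoved[OF path]; use far pos in \<open>fastforce simp: shadow_def\<close>)+
    have len: "length v = length w" "length w' = length w"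
      using center_path_length v(1) path by auto
    have "braid_at m v i"
      using start v(2) fix1 len i1 by (auto simp: braid_at_def)
    moreover have "braid_at m v (i + 1)"
      using final v(2) len i1 by (auto simp: braid_at_def)
    ultimately show False
      using reduced_no_adjacent_braids reduced_center_path[OF red v(1)] by blast
  qed
qed

lemma centers_not_adjacent:
  assumes "reduced_expression S m \<alpha>" "center_path m \<alpha> M x" "center_path m \<alpha> N y"
    and "braid_at m x i" "braid_at m y j"
  shows "j \<noteq> i + 1"
proof -
  have "center_path m x (rev M @ N) y"
    using center_path_rev[OF assms(1,2)] assms(3) center_path_append by blast
  then show ?thesis
    using no_adjacent_centers_on_path reduced_center_path assms by blast
qed

text \<open>The only other moves that could touch position \<open>i\<close> have their middle at \<open>i - 1\<close> or \<open>i + 1\<close>,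
  which the previous lemma excludes.\<close>

lemma center_letter_unmoved:
  assumes red: "reduced_expression S m \<alpha>" and x: "center_path m \<alpha> N x" "braid_at m x i"
    and path: "center_path m \<alpha> M \<beta>" and i: "i \<notin> set M"
  shows "\<beta> ! i = \<alpha> ! i"
proof (rule center_path_unmoved[OF path])
  fix j assume j: "j \<in> set M"
  then obtain M1 M2 where "M = M1 @ j # M2" by (meson split_list)
  then obtain y where y: "center_path m \<alpha> M1 y" "braid_at m y j"
    using path by (auto simp: center_path_append)
  have "j \<noteq> i + 1" "i \<noteq> j + 1"
    using centers_not_adjacent[OF red x(1) y(1) x(2) y(2)]
      centers_not_adjacent[OF red y(1) x(1) y(2) x(2)] by auto
  then show "i \<notin> shadow j"
    using i j y(2) by (auto simp: shadow_def braid_at_def)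
qed

section \<open>Forced moves and repeated moves\<close>

text \<open>A single move at \<open>i\<close> puts a new letter in position \<open>i\<close>, and no other move can restore the old
  one or produce the new one.\<close>

lemma distinct_centers_forced:
  assumes red: "reduced_expression S m \<alpha>"
    and M: "center_path m \<alpha> M \<beta>" "distinct M" and N: "center_path m \<alpha> N \<beta>"
  shows "set M \<subseteq> set N"
proof
  fix i assume "i \<in> set M"
  then obtain M1 M2 where split: "M = M1 @ i # M2" by (meson split_list)
  obtain x where x: "center_path m \<alpha> M1 x" "braid_at m x i" "center_path m (flip i x) M2 \<beta>"
    using M(1) by (auto simp: split center_path_append)
  have redx: "reduced_expression S m x" using red x(1) reduced_center_path by blast
  have "x ! i = \<alpha> ! i"
    using center_letter_unmoved[OF red x(1,2) x(1)] M(2) split by auto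
  moreover have "\<beta> ! i = flip i x ! i"
    using center_letter_unmoved[OF reduced_flip[OF redx x(2)] _ braid_at_flip[OF redx x(2)] x(3),
      of "[]"] M(2) split by auto
  moreover have "x ! (i - 1) \<noteq> x ! i"
    using x(2) m_eq_3_neq[of "x ! (i - 1)" "x ! i"] reduced_nth[OF redx, of "i - 1"]
    unfolding braid_at_def by linarith
  ultimately have "\<beta> ! i \<noteq> \<alpha> ! i"
    by (simp add: nth_flip[OF x(2)])
  then show "i \<in> set N"
    using center_letter_unmoved[OF red x(1,2) N] by blast
qed

text \<open>Only moves at \<open>i\<close> and \<open>k\<close> change the letters in position \<open>i\<close>, in position \<open>k\<close> and in the
  position \<open>z\<close> between them. One move at \<open>k\<close> between two moves at \<open>i\<close> requires each two of the
  three letters to be joined in the Coxeter graph.\<close>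

lemma overlapping_center_repeats:
  assumes red: "reduced_expression S m w"
    and no_triangle: "\<not> (\<exists>a\<in>S. \<exists>b\<in>S. \<exists>c\<in>S. m a b = 3 \<and> m b c = 3 \<and> m c a = 3)"
    and path: "center_path m w (i # M @ [i]) w'" and M: "i \<notin> set M" "distinct M"
    and k: "k = i + 2 \<or> i = k + 2"
  shows "k \<notin> set M"
proof
  assume "k \<in> set M"
  then obtain M1 M2 where split: "M = M1 @ k # M2" by (meson split_list)
  let ?w = "flip i w"
  define z where "z = (if k = i + 2 then i + 1 else i - 1)"
  obtain x v where b: "braid_at m w i" and x: "center_path m ?w M1 x" "braid_at m x k"
    and v: "center_path m (flip k x) M2 v" "braid_at m v i"
    using path by (auto simp: split center_path_append)
  have i1: "1 \<le> i" and k1: "1 \<le> k" using b x(2) by (auto simp: braid_at_def)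
  have redw: "reduced_expression S m ?w" using red b reduced_flip by blast
  have redx: "reduced_expression S m x" using redw x(1) reduced_center_path by blast
  have bw: "braid_at m ?w i" using red b braid_at_flip by blast
  have pv: "center_path m ?w (M1 @ k # M2) v"
    using x v by (auto simp: center_path_append)
  have far: "j \<noteq> i + 1 \<and> i \<noteq> j + 1" if j: "j \<in> set M" for j
  proof -
    obtain N1 N2 where "M = N1 @ j # N2" using j by (meson split_list)
    then obtain y where y: "center_path m ?w N1 y" "braid_at m y j"
      using pv split by (auto simp: center_path_append)
    have "center_path m ?w [] ?w" by simp
    then show ?thesis
      using centers_not_adjacent[OF redw] bw y by metis
  qed
  have still: "i \<notin> shadow j \<and> z \<notin> shadow j" if "j \<in> set M1 \<union> set M2" for j
    using that far[of j] M k i1 k1 by (auto simp: shadow_def z_def split split: if_splits)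
  have x_eq: "x ! i = ?w ! i" "x ! z = ?w ! z"
    by (rule center_path_unmoved[OF x(1)]; use still in blast)+
  have v_eq: "v ! i = flip k x ! i" "v ! z = flip k x ! z"
    by (rule center_path_unmoved[OF v(1)]; use still in blast)+
  have k_eq: "flip k x ! i = x ! i" "flip k x ! z = x ! k"
    using k i1 k1 by (auto simp: nth_flip[OF x(2)] z_def)
  let ?a = "x ! i" and ?b = "x ! z" and ?c = "x ! k"
  have "m ?b ?a = 3"
    using bw x_eq by (auto simp: braid_at_def z_def)
  moreover have "m ?b ?c = 3"
    using x(2) k i1 k1 by (auto simp: braid_at_def z_def)
  moreover have "m (v ! z) (v ! i) = 3"
    using v(2) by (auto simp: braid_at_def z_def)
  then have "m ?c ?a = 3"
    using v_eq k_eq by simp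
  moreover have "i < length x" "z < length x" "k < length x"
    using bw x(2) center_path_length[OF x(1)] by (auto simp: braid_at_def z_def)
  ultimately show False
    using no_triangle m_eq_3_sym reduced_nth[OF redx] by metis
qed

text \<open>The moves in between have shadows disjoint from that of \<open>i\<close>, so they commute with the move
  at \<open>i\<close>, which is an involution.\<close>

lemma cancel_repeated_center:
  assumes red: "reduced_expression S m w"
    and no_triangle: "\<not> (\<exists>a\<in>S. \<exists>b\<in>S. \<exists>c\<in>S. m a b = 3 \<and> m b c = 3 \<and> m c a = 3)"
    and path: "center_path m w (i # M @ [i]) w'" and M: "i \<notin> set M" "distinct M"
  shows "center_path m w M w'"
proof -
  \<comment> \<open>The moves of \<open>M\<close> all lie in the window \<open>?P\<close>, where \<open>w\<close> and \<open>?w\<close> agree.\<close>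
  let ?w = "flip i w" and ?P = "- shadow i"
  obtain v where b: "braid_at m w i" and v: "center_path m ?w M v" "braid_at m v i"
    and w': "w' = flip i v"
    using path by (auto simp: center_path_append)
  have redw: "reduced_expression S m ?w" using red b reduced_flip by blast
  have bw: "braid_at m ?w i" using red b braid_at_flip by blast
  have disj: "shadow j \<subseteq> ?P" if j: "j \<in> set M" for j
  proof -
    obtain N1 N2 where "M = N1 @ j # N2" using j by (meson split_list)
    then obtain y where y: "center_path m ?w N1 y" "braid_at m y j"
      using v by (auto simp: center_path_append)
    have "center_path m ?w [] ?w" by simp
    then have "j \<noteq> i + 1" "i \<noteq> j + 1"
      using centers_not_adjacent[OF redw] bw y by metis+
    moreover have "j \<noteq> i + 2" "i \<noteq> j + 2"
      using overlapping_center_repeats[OF red no_triangle path M] j by auto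
    moreover have "j \<noteq> i" "1 \<le> i" "1 \<le> j"
      using M j b y(2) by (auto simp: braid_at_def)
    ultimately show ?thesis by (auto simp: shadow_def)
  qed
  have "filter (\<lambda>j. shadow j \<subseteq> ?P) M = M"
    using disj by simp
  then obtain v' where v': "center_path m w M v'" "\<forall>p. v' ! p = (if p \<in> ?P then v else w) ! p"
    using center_path_localize[OF v(1), of ?P w] disj nth_flip_outside[of _ i w] by auto
  have keep: "v ! p = ?w ! p" if "p \<in> shadow i" for p
    by (rule center_path_unmoved[OF v(1)]) (use disj that in blast)
  have "v' = w'"
  proof (rule nth_equalityI)
    show "length v' = length w'"
      using center_path_length[OF v'(1)] center_path_length[OF path] by simp
    fix p
    show "v' ! p = w' ! p"
    proof (cases "p \<in> shadow i")
      case True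
      have "i - 1 \<in> shadow i" "i \<in> shadow i" by (auto simp: shadow_def)
      then have "w' ! p = flip i ?w ! p"
        using True keep unfolding w' nth_flip[OF v(2)] nth_flip[OF bw] by simp
      then show ?thesis
        using True v'(2) flip_flip[OF red b] by simp
    next
      case False
      then show ?thesis
        using v'(2) nth_flip_outside[of p i v] w' by simp
    qed
  qed
  then show ?thesis using v'(1) by simp
qed

end

lemma innermost_repetition:
  "\<not> distinct xs \<Longrightarrow> \<exists>A x M B. xs = A @ x # M @ x # B \<and> x \<notin> set M \<and> distinct M"
proof (induction "length xs" arbitrary: xs rule: less_induct)
  case less
  obtain A x M B where xs: "xs = A @ [x] @ M @ [x] @ B"
    using not_distinct_decomp[OF less.prems] by blast
  show ?case
  proof (cases "distinct (x # M)")
    case True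
    then show ?thesis using xs by auto
  next
    case False
    have "length (x # M) < length xs" by (simp add: xs)
    then obtain A' x' M' B' where dec: "x # M = A' @ x' # M' @ x' # B'" "x' \<notin> set M'" "distinct M'"
      using less.hyps False by blast
    have "xs = A @ (x # M) @ [x] @ B" by (simp add: xs)
    then have "xs = (A @ A') @ x' # M' @ x' # (B' @ [x] @ B)"
      unfolding dec(1) by simp
    then show ?thesis using dec(2,3) by blast
  qed
qed

lemma (in coxeter_system) repetition_shortens:
  assumes red: "reduced_expression S m \<alpha>"
    and no_triangle: "\<not> (\<exists>a\<in>S. \<exists>b\<in>S. \<exists>c\<in>S. m a b = 3 \<and> m b c = 3 \<and> m c a = 3)"
    and path: "center_path m \<alpha> M \<beta>" and rep: "\<not> distinct M"
  shows "\<exists>N. center_path m \<alpha> N \<beta> \<and> length N < length M"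
proof -
  obtain A i K B where M: "M = A @ i # K @ i # B" and K: "i \<notin> set K" "distinct K"
    using innermost_repetition[OF rep] by blast
  have "M = A @ (i # K @ [i]) @ B" by (simp add: M)
  then have "center_path m \<alpha> (A @ (i # K @ [i]) @ B) \<beta>" using path by simp
  then obtain x y where xy: "center_path m \<alpha> A x" "center_path m x (i # K @ [i]) y"
    "center_path m y B \<beta>"
    unfolding center_path_append[of m _ A] center_path_append[of m _ "i # K @ [i]"] by blast
  have "center_path m x K y"
    using cancel_repeated_center[OF _ no_triangle xy(2) K] red xy(1) reduced_center_path by blast
  then have "center_path m \<alpha> (A @ K @ B) \<beta>"
    using xy unfolding center_path_append by blast
  then show ?thesis by (intro exI[of _ "A @ K @ B"]) (simp add: M)
qed

section \<open>Numbering the shadows\<close>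

lemma braid_class_trans:
  "x \<in> braid_class m \<gamma> \<Longrightarrow> braid_at m x i \<Longrightarrow> flip i x \<in> braid_class m \<gamma>"
  unfolding braid_class_def braid_equivalent_def mem_Collect_eq
  by (rule rtranclp.rtrancl_into_rtrancl) (auto simp: braid_move_def braid_move_in_iff)

lemma shadow_in_class_shadows:
  "x \<in> braid_class m \<gamma> \<Longrightarrow> braid_at m x i \<Longrightarrow> shadow i \<in> class_shadows m \<gamma>"
  by (auto simp: class_shadows_def shadows_def shadow_def)

lemma braid_path_iff:
  assumes "x \<in> braid_class m \<gamma>"
  shows "braid_path m \<gamma> x js \<beta> \<longleftrightarrow>
    (\<exists>M. js = map (\<lambda>i. shadow_number m \<gamma> (shadow i)) M \<and> center_path m x M \<beta>)"
  using assms
proof (induction js arbitrary: x)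
  case (Cons j js)
  have "braid_path m \<gamma> x (j # js) \<beta> \<longleftrightarrow> (\<exists>i. shadow_number m \<gamma> (shadow i) = j \<and>
      braid_at m x i \<and> braid_path m \<gamma> (flip i x) js \<beta>)"
    using shadow_in_class_shadows[OF Cons.prems] by (auto simp: braid_move_in_iff)
  also have "\<dots> \<longleftrightarrow> (\<exists>i M. shadow_number m \<gamma> (shadow i) = j \<and> braid_at m x i \<and>
      js = map (\<lambda>i. shadow_number m \<gamma> (shadow i)) M \<and> center_path m (flip i x) M \<beta>)"
    using Cons.IH braid_class_trans[OF Cons.prems] by blast
  also have "\<dots> \<longleftrightarrow> (\<exists>M. j # js = map (\<lambda>i. shadow_number m \<gamma> (shadow i)) M \<and>
      center_path m x M \<beta>)"
  proof (intro iffI; elim exE conjE)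
    fix i M
    assume "shadow_number m \<gamma> (shadow i) = j" "braid_at m x i"
      "js = map (\<lambda>i. shadow_number m \<gamma> (shadow i)) M" "center_path m (flip i x) M \<beta>"
    then show "\<exists>M. j # js = map (\<lambda>i. shadow_number m \<gamma> (shadow i)) M \<and> center_path m x M \<beta>"
      by (intro exI[of _ "i # M"]) simp
  next
    fix N
    assume "j # js = map (\<lambda>i. shadow_number m \<gamma> (shadow i)) N" "center_path m x N \<beta>"
    then show "\<exists>i M. shadow_number m \<gamma> (shadow i) = j \<and> braid_at m x i \<and>
        js = map (\<lambda>i. shadow_number m \<gamma> (shadow i)) M \<and> center_path m (flip i x) M \<beta>"
      by (cases N) auto
  qed
  finally show ?case .
qed auto

lemma braid_class_length: "x \<in> braid_class m \<gamma> \<Longrightarrow> length x = length \<gamma>"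
  unfolding braid_class_def braid_equivalent_def mem_Collect_eq
  by (induction rule: rtranclp_induct) (auto simp: braid_move_def braid_move_in_iff)

lemma finite_class_shadows: "finite (class_shadows m \<gamma>)"
proof (rule finite_subset)
  show "class_shadows m \<gamma> \<subseteq> shadow ` {..<length \<gamma>}"
    by (force simp: class_shadows_def shadows_def shadow_def braid_at_def
        dest: braid_class_length)
qed simp

lemma Min_shadow: "Min (shadow i) = i - 1"
  by (auto simp: shadow_def)

text \<open>The shadow of \<open>k\<close> itself is counted on the right only.\<close>

lemma shadow_number_less:
  assumes "shadow k \<in> class_shadows m \<gamma>" "i - 1 < k - 1"
  shows "shadow_number m \<gamma> (shadow i) < shadow_number m \<gamma> (shadow k)"
  unfolding shadow_number_def
proof (rule psubset_card_mono)
  show "finite {Y \<in> class_shadows m \<gamma>. Min Y \<le> Min (shadow k)}"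
    by (rule finite_subset[OF _ finite_class_shadows]) auto
  have "shadow k \<notin> {Y \<in> class_shadows m \<gamma>. Min Y \<le> Min (shadow i)}"
    "shadow k \<in> {Y \<in> class_shadows m \<gamma>. Min Y \<le> Min (shadow k)}"
    using assms by (auto simp: Min_shadow)
  moreover have "{Y \<in> class_shadows m \<gamma>. Min Y \<le> Min (shadow i)} \<subseteq>
      {Y \<in> class_shadows m \<gamma>. Min Y \<le> Min (shadow k)}"
    using assms(2) by (auto simp: Min_shadow)
  ultimately show "{Y \<in> class_shadows m \<gamma>. Min Y \<le> Min (shadow i)} \<subset>
      {Y \<in> class_shadows m \<gamma>. Min Y \<le> Min (shadow k)}"
    by blast
qed

text \<open>Positivity matters: with truncated subtraction, middle positions \<open>0\<close> and \<open>1\<close> would give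
  shadows with the same minimum.\<close>

lemma shadow_number_inj:
  assumes "shadow i \<in> class_shadows m \<gamma>" "shadow k \<in> class_shadows m \<gamma>" "1 \<le> i" "1 \<le> k"
    and "shadow_number m \<gamma> (shadow i) = shadow_number m \<gamma> (shadow k)"
  shows "i = k"
proof (rule ccontr)
  assume "i \<noteq> k"
  then consider "i - 1 < k - 1" | "k - 1 < i - 1" using assms(3,4) by linarith
  then show False
    using shadow_number_less assms by (metis less_irrefl)
qed

lemma center_path_shadows:
  "center_path m x M \<beta> \<Longrightarrow> x \<in> braid_class m \<gamma> \<Longrightarrow> i \<in> set M \<Longrightarrow>
    shadow i \<in> class_shadows m \<gamma> \<and> 1 \<le> i"
proof (induction M arbitrary: x)
  case (Cons k M)
  then have "shadow k \<in> class_shadows m \<gamma>" "1 \<le> k"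
    by (auto simp: braid_at_def intro: shadow_in_class_shadows)
  moreover have "flip k x \<in> braid_class m \<gamma>"
    using Cons.prems by (auto intro: braid_class_trans)
  ultimately show ?case
    using Cons.IH[of "flip k x"] Cons.prems by auto
qed simp

lemma distinct_shadow_numbers:
  assumes "center_path m \<gamma> M \<beta>"
  shows "distinct (map (\<lambda>i. shadow_number m \<gamma> (shadow i)) M) \<longleftrightarrow> distinct M"
proof -
  have "\<gamma> \<in> braid_class m \<gamma>" by (simp add: braid_class_def braid_equivalent_def)
  then have "inj_on (\<lambda>i. shadow_number m \<gamma> (shadow i)) (set M)"
    using center_path_shadows[OF assms] shadow_number_inj by (blast intro: inj_onI)
  then show ?thesis by (simp add: distinct_map)
qed

lemma braid_sequence_iff:
  "braid_sequence m \<alpha> js \<beta> \<longleftrightarrow>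
    (\<exists>M. js = map (\<lambda>i. shadow_number m \<alpha> (shadow i)) M \<and> center_path m \<alpha> M \<beta>)"
  unfolding braid_sequence_def
  by (rule braid_path_iff) (simp add: braid_class_def braid_equivalent_def)

section \<open>Minimal braid sequences\<close>

theorem proposition5p1:
  fixes S :: "'s set" and m :: "'s \<Rightarrow> 's \<Rightarrow> enat"
    and \<alpha> \<beta> :: "'s list" and js :: "nat list"
  assumes "type_Lambda S m"
    and "reduced_expression S m \<alpha>"
    and "reduced_expression S m \<beta>"
    and "braid_equivalent m \<alpha> \<beta>"
    and "1 \<le> dimension m \<alpha>"
    and "1 \<le> dimension m \<beta>"
    and "braid_sequence m \<alpha> js \<beta>"
  shows "minimal_braid_sequence m \<alpha> js \<beta> \<longleftrightarrow> distinct js"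
proof -
  interpret coxeter_system S m
    using assms(1) by unfold_locales (simp add: type_Lambda_def)
  have no_triangle: "\<not> (\<exists>a\<in>S. \<exists>b\<in>S. \<exists>c\<in>S. m a b = 3 \<and> m b c = 3 \<and> m c a = 3)"
  proof
    assume "\<exists>a\<in>S. \<exists>b\<in>S. \<exists>c\<in>S. m a b = 3 \<and> m b c = 3 \<and> m c a = 3"
    then obtain a b c where "a \<in> S" "b \<in> S" "c \<in> S" "m a b = 3" "m b c = 3" "m c a = 3"
      by blast
    then have "coxeter_edge S m a b \<and> coxeter_edge S m b c \<and> coxeter_edge S m c a"
      using m_eq_3_neq by (auto simp: coxeter_edge_def)
    then show False using assms(1) unfolding type_Lambda_def by blast
  qed
  obtain M where M: "js = map (\<lambda>i. shadow_number m \<alpha> (shadow i)) M" "center_path m \<alpha> M \<beta>"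
    using assms(7) braid_sequence_iff by blast
  have dist: "distinct js \<longleftrightarrow> distinct M"
    using distinct_shadow_numbers[OF M(2)] M(1) by simp
  have "minimal_braid_sequence m \<alpha> js \<beta> \<longleftrightarrow>
      (\<forall>N. center_path m \<alpha> N \<beta> \<longrightarrow> length M \<le> length N)"
    using assms(7) M(1) by (auto simp: minimal_braid_sequence_def braid_sequence_iff)
  also have "\<dots> \<longleftrightarrow> distinct M"
  proof
    assume "\<forall>N. center_path m \<alpha> N \<beta> \<longrightarrow> length M \<le> length N"
    then show "distinct M"
      using repetition_shortens[OF assms(2) no_triangle M(2)] by (meson leD)
  next
    assume d: "distinct M"
    show "\<forall>N. center_path m \<alpha> N \<beta> \<longrightarrow> length M \<le> length N"
    proof (intro allI impI)
      fix N assume "center_path m \<alpha> N \<beta>"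
      then have "card (set M) \<le> card (set N)"
        using distinct_centers_forced[OF assms(2) M(2) d] by (simp add: card_mono)
      then show "length M \<le> length N"
        using distinct_card[OF d] card_length[of N] by linarith
    qed
  qed
  finally show ?thesis using dist by simp
qed

end
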